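(* Let $n\ge3$ be a deficient number, i.e. $\sigma(n)<2n$ where $\sigma(n)$ is the sum of the positive divisors of $n$. Then $\Gamma_N(D_n)$ is not Hamiltonian, where $D_n=\langle a,b\mid a^n=b^2=1,\ ab=ba^{-1}\rangle$.
   Context: $\Gamma_N(G)$ denotes the simple graph whose vertices are the proper non-normal subgroups of the group $G$, two distinct vertices $H,K$ being adjacent iff $HK=KH$. A graph is Hamiltonian if it has a cycle through all its vertices. *)

theory Defs
  imports "HOL-Algebra.Coset" "Graph_Theory.Graph_Theory"
begin

section \<open>Groups given by generators and relations\<close>

text \<open>
  A letter \<open>(g, True)\<close> stands for the generator \<open>g\<close>, a letter \<open>(g, False)\<close> for its formal
  inverse.  A set of relations is a set of pairs \<open>(u, v)\<close> of words, read as \<open>u = v\<close>.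
\<close>

type_synonym 'g gword = "('g \<times> bool) list"

inductive word_cong :: "('g gword \<times> 'g gword) set \<Rightarrow> 'g gword \<Rightarrow> 'g gword \<Rightarrow> bool"
  for R :: "('g gword \<times> 'g gword) set"
where
  wc_refl: "word_cong R u u"
| wc_sym: "word_cong R u v \<Longrightarrow> word_cong R v u"
| wc_trans: "word_cong R u v \<Longrightarrow> word_cong R v w \<Longrightarrow> word_cong R u w"
| wc_append: "word_cong R u u' \<Longrightarrow> word_cong R v v' \<Longrightarrow> word_cong R (u @ v) (u' @ v')"
| wc_cancel: "word_cong R [(g, e), (g, \<not> e)] []"
| wc_relation: "(u, v) \<in> R \<Longrightarrow> word_cong R u v"

definition word_cong_rel :: "('g gword \<times> 'g gword) set \<Rightarrow> 'g gword rel" where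
  "word_cong_rel R = {(u, v). word_cong R u v}"

text \<open>All elements of the type \<open>'g\<close> are generators.\<close>

definition presented_group :: "('g gword \<times> 'g gword) set \<Rightarrow> 'g gword set monoid" where
  "presented_group R =
     \<lparr> carrier = UNIV // word_cong_rel R,
       monoid.mult = (\<lambda>U V. \<Union>u\<in>U. \<Union>v\<in>V. word_cong_rel R `` {u @ v}),
       one = word_cong_rel R `` {[]} \<rparr>"

lemma equiv_word_cong_rel: "equiv UNIV (word_cong_rel R)"
  by (rule equivI)
     (auto simp: word_cong_rel_def refl_on_def intro!: symI transI
           intro: wc_refl wc_sym wc_trans)

lemma word_class_eq_iff:
  "word_cong_rel R `` {u} = word_cong_rel R `` {v} \<longleftrightarrow> word_cong R u v"
  using eq_equiv_class_iff[OF equiv_word_cong_rel, of u v R]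
  by (simp add: word_cong_rel_def)

lemma word_class_mult:
  "word_cong_rel R `` {u} \<otimes>\<^bsub>presented_group R\<^esub> word_cong_rel R `` {v} = word_cong_rel R `` {u @ v}"
proof -
  have "congruent2 (word_cong_rel R) (word_cong_rel R) (\<lambda>u v. word_cong_rel R `` {u @ v})"
    unfolding congruent2_def word_class_eq_iff
    by (auto simp: word_cong_rel_def intro: wc_append)
  from UN_equiv_class2[OF equiv_word_cong_rel equiv_word_cong_rel this]
  show ?thesis by (simp add: presented_group_def)
qed

lemma word_class_in_carrier: "word_cong_rel R `` {u} \<in> carrier (presented_group R)"
  by (simp add: presented_group_def quotientI)

lemma word_class_cases:
  assumes "x \<in> carrier (presented_group R)"
  obtains u where "x = word_cong_rel R `` {u}"
  using assms by (auto simp: presented_group_def elim: quotientE)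

lemma word_cong_inverse:
  "word_cong R (rev (map (\<lambda>(g, e). (g, \<not> e)) u) @ u) []"
proof (induction u)
  case Nil
  show ?case by (simp add: wc_refl)
next
  case (Cons x u)
  obtain g e where x: "x = (g, e)" by (cases x)
  let ?v = "rev (map (\<lambda>(g, e). (g, \<not> e)) u)"
  have "word_cong R [(g, \<not> e), (g, e)] []"
    using wc_cancel[of R g "\<not> e"] by simp
  then have "word_cong R (?v @ [(g, \<not> e), (g, e)] @ u) (?v @ [] @ u)"
    by (intro wc_append wc_refl)
  then show ?case
    using Cons.IH wc_trans by (auto simp: x)
qed

lemma group_presented_group: "group (presented_group R)"
proof (rule groupI)
  fix x y assume "x \<in> carrier (presented_group R)" "y \<in> carrier (presented_group R)"
  then show "x \<otimes>\<^bsub>presented_group R\<^esub> y \<in> carrier (presented_group R)"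
    by (elim word_class_cases) (simp add: word_class_mult word_class_in_carrier)
next
  show "\<one>\<^bsub>presented_group R\<^esub> \<in> carrier (presented_group R)"
    by (simp add: presented_group_def quotientI)
next
  fix x y z
  assume "x \<in> carrier (presented_group R)" "y \<in> carrier (presented_group R)"
    "z \<in> carrier (presented_group R)"
  then show "x \<otimes>\<^bsub>presented_group R\<^esub> y \<otimes>\<^bsub>presented_group R\<^esub> z =
      x \<otimes>\<^bsub>presented_group R\<^esub> (y \<otimes>\<^bsub>presented_group R\<^esub> z)"
    by (elim word_class_cases) (simp add: word_class_mult)
next
  have one: "\<one>\<^bsub>presented_group R\<^esub> = word_cong_rel R `` {[]}"
    by (simp add: presented_group_def)
  fix x assume x: "x \<in> carrier (presented_group R)"
  then obtain u where u: "x = word_cong_rel R `` {u}"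
    by (rule word_class_cases)
  show "\<one>\<^bsub>presented_group R\<^esub> \<otimes>\<^bsub>presented_group R\<^esub> x = x"
    by (simp add: u one word_class_mult)
  show "\<exists>y\<in>carrier (presented_group R). y \<otimes>\<^bsub>presented_group R\<^esub> x = \<one>\<^bsub>presented_group R\<^esub>"
    unfolding u one
    by (rule bexI[OF _ word_class_in_carrier[of R "rev (map (\<lambda>(g, e). (g, \<not> e)) u)"]])
       (simp add: word_class_mult word_class_eq_iff word_cong_inverse)
qed


section \<open>Dihedral groups\<close>

datatype dihedral_gen = Gen_a | Gen_b

definition dihedral_relations :: "nat \<Rightarrow> (dihedral_gen gword \<times> dihedral_gen gword) set" where
  "dihedral_relations n =
     {(replicate n (Gen_a, True), []),
      (replicate 2 (Gen_b, True), []),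
      ([(Gen_a, True), (Gen_b, True)], [(Gen_b, True), (Gen_a, False)])}"

definition dihedral_group :: "nat \<Rightarrow> dihedral_gen gword set monoid" where
  "dihedral_group n = presented_group (dihedral_relations n)"

lemma group_dihedral_group: "group (dihedral_group n)"
  by (simp add: dihedral_group_def group_presented_group)


section \<open>The permutability graph of non-normal subgroups\<close>

text \<open>As usual in this library, an undirected edge is a pair of opposite arcs.\<close>

definition permutability_graph_N :: "('a, 'm) monoid_scheme \<Rightarrow> 'a set pair_pre_digraph"
    (\<open>\<Gamma>\<^sub>N\<close>) where
  "\<Gamma>\<^sub>N G =
     (let V = {H. subgroup H G \<and> H \<noteq> carrier G \<and> \<not> H \<lhd> G}
      in \<lparr> pverts = V,
           parcs = {(H, K). H \<in> V \<and> K \<in> V \<and> H \<noteq> K \<and> H <#>\<^bsub>G\<^esub> K = K <#>\<^bsub>G\<^esub> H} \<rparr>)"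

lemma pair_graph_permutability_graph_N:
  assumes "finite (carrier G)"
  shows "pair_graph (\<Gamma>\<^sub>N G)"
proof -
  have V: "finite (pverts (\<Gamma>\<^sub>N G))"
    by (rule finite_subset[of _ "Pow (carrier G)"])
       (auto simp: permutability_graph_N_def Let_def assms dest: subgroup.subset)
  have "finite (parcs (\<Gamma>\<^sub>N G))"
    by (rule finite_subset[OF _ finite_cartesian_product[OF V V]])
       (auto simp: permutability_graph_N_def Let_def)
  with V show ?thesis
    by unfold_locales
       (auto simp: permutability_graph_N_def Let_def symmetric_def intro!: symI)
qed


section \<open>Hamiltonian graphs\<close>

text \<open>
  The bound on the length excludes the closed walk \<open>u, v, u\<close> along a single edge, which
  \<^const>\<open>pre_digraph.cycle\<close> admits because undirected graphs are symmetric digraphs there.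
\<close>

definition (in pre_digraph) hamiltonian :: bool where
  "hamiltonian \<longleftrightarrow> (\<exists>p. cycle p \<and> 3 \<le> length p \<and> tail G ` set p = verts G)"


section \<open>Deficient numbers\<close>

definition sum_of_divisors :: "nat \<Rightarrow> nat" (\<open>\<sigma>\<close>) where
  "\<sigma> n = (\<Sum>d | d dvd n. d)"

definition deficient :: "nat \<Rightarrow> bool" where
  "deficient n \<longleftrightarrow> \<sigma> n < 2 * n"

end

theory Submission
  imports Defs "HOL-Computational_Algebra.Primes"
begin

text \<open>
  Apart from rotation subgroups, which are normal, every subgroup of \<open>D\<^sub>n\<close> is
  \<open>H d i = \<langle>a\<^sup>d, a\<^sup>i b\<rangle>\<close> with \<open>d dvd n\<close> and \<open>0 \<le> i < d\<close>; it is non-normal iff \<open>d \<ge> 3\<close>, and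
  \<open>H d i\<close>, \<open>H e j\<close> permute iff \<open>gcd d e dvd 2 (i - j)\<close>.  Write \<open>n = 2\<^sup>k m\<close> with \<open>m\<close> odd.
  The divisors \<open>d\<close> of \<open>n\<close> with \<open>m dvd d\<close> add up to \<open>2n - m\<close>, so deficiency leaves fewer than \<open>m\<close>
  vertices \<open>H d i\<close> with \<open>\<not> m dvd d\<close>.  If \<open>m > 1\<close>, deleting these leaves at least \<open>m\<close> components,
  because \<open>i mod m\<close> is constant along the remaining edges.  If \<open>m = 1\<close>, then \<open>4 dvd d\<close> for
  every vertex, and the parity of \<open>i\<close> disconnects the graph.
\<close>


section \<open>Hamiltonian cycles and coloured vertex cuts\<close>

lemma (in pre_digraph) cas_invariant:
  assumes "cas u p v" "u \<in> X"
    and "\<And>e. e \<in> set p \<Longrightarrow> tail G e \<in> X \<Longrightarrow> head G e \<in> X"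
  shows "v \<in> X \<and> tail G ` set p \<subseteq> X"
  using assms
proof (induction p arbitrary: u)
  case (Cons e p)
  have "cas (head G e) p v" "tail G e \<in> X" using Cons.prems by auto
  with Cons.IH[of "head G e"] Cons.prems(3) show ?case by auto
qed simp

text \<open>The start of a closed walk is arbitrary: from \<open>e\<close> the walk runs on to its
  end \<open>u\<close>, so \<open>u\<close> lies in \<open>X\<close>, and the invariant then
  propagates from \<open>u\<close> along all of \<open>p\<close>.\<close>

lemma (in pre_digraph) closed_cas_invariant:
  assumes "cas u p u" "e \<in> set p" "tail G e \<in> X"
    and inv: "\<And>e. e \<in> set p \<Longrightarrow> tail G e \<in> X \<Longrightarrow> head G e \<in> X"
  shows "tail G ` set p \<subseteq> X"
proof -
  obtain q r where p: "p = q @ e # r" using split_list[OF assms(2)] by blast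
  have "cas (tail G e) (e # r) u" using assms(1) by (auto simp: p cas_append_iff)
  then have "u \<in> X" using cas_invariant[of "tail G e" "e # r" u X] assms(3) inv by (auto simp: p)
  then show ?thesis using cas_invariant[OF assms(1) _ inv] by blast
qed

text \<open>A Hamiltonian cycle leaves every colour class through a vertex of \<open>S\<close>, and it
  enters each vertex of \<open>S\<close> only once.\<close>

lemma (in pre_digraph) not_hamiltonian_coloured_cut:
  assumes fin: "finite S"
    and col: "\<And>e. e \<in> arcs G \<Longrightarrow> tail G e \<notin> S \<Longrightarrow> head G e \<notin> S \<Longrightarrow> f (tail G e) = f (head G e)"
    and cut: "card S < card (f ` (verts G - S))" "2 \<le> card (f ` (verts G - S))"
  shows "\<not> hamiltonian"
proof
  let ?C = "f ` (verts G - S)"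
  assume hamiltonian
  then obtain u p where p: "awalk u p u" "distinct (tl (awalk_verts u p))"
    and tails: "tail G ` set p = verts G"
    by (auto simp: hamiltonian_def cycle_def)
  have cas: "cas u p u" and arcs: "set p \<subseteq> arcs G" using p(1) by (auto simp: awalk_def)
  \<comment> \<open>The vertices after the first are the heads of the arcs, so the arcs of a cycle
    have pairwise distinct heads.\<close>
  have "tl (awalk_verts u p) = map (head G) p"
    using awalk_verts_conv'[OF cas] by (cases p) auto
  then have dist: "inj_on (head G) (set p)" using p(2) by (simp add: distinct_map)
  have "\<exists>e\<in>set p. tail G e \<notin> S \<and> f (tail G e) = x \<and> head G e \<in> S" if x: "x \<in> ?C" for x
  proof (rule ccontr)
    assume stay: "\<not> ?thesis"
    \<comment> \<open>Without an arc from colour \<open>x\<close> into \<open>S\<close>, this class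
      would be closed along the cycle, since \<open>col\<close> preserves colours off
      \<open>S\<close>; then \<open>x\<close> would be the only colour.\<close>
    let ?X = "{v. v \<notin> S \<and> f v = x}"
    obtain e where e: "e \<in> set p" "tail G e \<in> ?X"
    proof -
      obtain v where v: "v \<in> verts G" "v \<notin> S" "f v = x" using x by blast
      from v(1) obtain e where "e \<in> set p" "v = tail G e" unfolding tails[symmetric] by blast
      with v that show ?thesis by blast
    qed
    have "tail G ` set p \<subseteq> ?X"
    proof (rule closed_cas_invariant[OF cas e])
      fix e assume e: "e \<in> set p" "tail G e \<in> ?X"
      then have "head G e \<notin> S" using stay by blast
      with e show "head G e \<in> ?X" using col[of e] arcs by auto
    qed
    then have "?C \<subseteq> {x}" using tails by auto
    then have "card ?C \<le> 1" using card_mono[of "{x}" ?C] by simp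
    with cut(2) show False by simp
  qed
  then obtain e where e: "\<And>x. x \<in> ?C \<Longrightarrow>
      e x \<in> set p \<and> tail G (e x) \<notin> S \<and> f (tail G (e x)) = x \<and> head G (e x) \<in> S"
    by metis
  have "inj_on (\<lambda>x. head G (e x)) ?C"
  proof (rule inj_onI)
    fix x y assume xy: "x \<in> ?C" "y \<in> ?C" "head G (e x) = head G (e y)"
    then have "e x = e y" using e[OF xy(1)] e[OF xy(2)] inj_onD[OF dist, of "e x" "e y"] by blast
    with e[OF xy(1)] e[OF xy(2)] show "x = y" by metis
  qed
  moreover have "(\<lambda>x. head G (e x)) ` ?C \<subseteq> S" using e by blast
  ultimately have "card ?C \<le> card S" using card_inj_on_le[OF _ _ fin] by blast
  with cut(1) show False by simp
qed


section \<open>Subgroups of a dihedral group\<close>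

text \<open>With \<open>rot i\<close> for a^i and \<open>refl i\<close> for a^i b, integer exponents
  turn questions about subgroups into congruences, without any words.\<close>

locale dihedral = group G for G (structure) +
  fixes n :: nat and rot refl :: "int \<Rightarrow> 'a"
  assumes n_pos: "n > 0"
    and carrier_eq: "carrier G = range rot \<union> range refl"
    and rot_rot: "rot i \<otimes> rot j = rot (i + j)"
    and rot_refl: "rot i \<otimes> refl j = refl (i + j)"
    and refl_rot: "refl i \<otimes> rot j = refl (i - j)"
    and refl_refl: "refl i \<otimes> refl j = rot (i - j)"
    and rot_eq_iff: "rot i = rot j \<longleftrightarrow> int n dvd i - j"
    and refl_eq_iff: "refl i = refl j \<longleftrightarrow> int n dvd i - j"
    and rot_neq_refl: "rot i \<noteq> refl j"
begin

lemma rot_closed [simp]: "rot i \<in> carrier G" and refl_closed [simp]: "refl i \<in> carrier G"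
  by (auto simp: carrier_eq)

lemma one_eq: "\<one> = rot 0"
  using rot_rot[of 0 0] by (simp add: l_cancel_one)

lemma inv_rot: "inv rot i = rot (- i)"
  by (rule inv_equality) (simp_all add: rot_rot one_eq)

lemma inv_refl: "inv refl i = refl i"
  by (rule inv_equality) (simp_all add: refl_refl one_eq)

lemmas mult_simps = rot_rot rot_refl refl_rot refl_refl inv_rot inv_refl

section \<open>Rotation part of a subgroup and criteria for normality\<close>

lemma subgroup_rot_mult:
  assumes "subgroup H G" "rot i \<in> H"
  shows "rot (i * k) \<in> H"
proof -
  interpret subgroup H G by (rule assms)
  have nat: "rot (j * int l) \<in> H" if "rot j \<in> H" for j l
  proof (induction l)
    case 0 show ?case using one_closed by (simp add: one_eq)
  next
    case (Suc l)
    then show ?case using m_closed[OF that Suc] by (simp add: rot_rot algebra_simps)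
  qed
  have "rot (- i) \<in> H" using m_inv_closed[OF assms(2)] by (simp add: inv_rot)
  then show ?thesis
    using nat[OF assms(2), of "nat k"] nat[of "- i" "nat (- k)"] by (cases "k \<ge> 0") auto
qed

lemma subgroup_rot_generator:
  assumes H: "subgroup H G"
  obtains d where "d > 0" "d dvd n" "\<And>i. rot i \<in> H \<longleftrightarrow> int d dvd i"
proof -
  interpret subgroup H G by (rule H)
  have n: "rot (int n) = rot 0" by (simp add: rot_eq_iff)
  \<comment> \<open>The minimum exists because \<open>rot (int n)\<close> is the identity; a nonzero
    remainder modulo \<open>d\<close> would be a smaller exponent.\<close>
  define d where "d = (LEAST d. d > 0 \<and> rot (int d) \<in> H)"
  have "n > 0 \<and> rot (int n) \<in> H" using n_pos n one_closed by (simp add: one_eq)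
  then have d: "d > 0" "rot (int d) \<in> H"
    unfolding d_def by (metis (mono_tags, lifting) LeastI)+
  have iff: "rot i \<in> H \<longleftrightarrow> int d dvd i" for i
  proof
    assume "int d dvd i"
    then show "rot i \<in> H" using subgroup_rot_mult[OF H d(2)] by (auto elim!: dvdE)
  next
    assume i: "rot i \<in> H"
    have "rot i \<otimes> rot (int d * (- (i div int d))) \<in> H"
      by (intro m_closed i subgroup_rot_mult[OF H d(2)])
    then have r: "rot (i mod int d) \<in> H"
      by (simp add: rot_rot minus_mult_div_eq_mod)
    have "i mod int d \<ge> 0" "i mod int d < int d" using d(1) by auto
    then have "\<not> (nat (i mod int d) > 0)"
      using not_less_Least[of "nat (i mod int d)" "\<lambda>d. d > 0 \<and> rot (int d) \<in> H"] r
      by (auto simp: d_def[symmetric])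
    then show "int d dvd i" using \<open>i mod int d \<ge> 0\<close> by (simp add: dvd_eq_mod_eq_0)
  qed
  have "int d dvd int n" using iff n one_closed by (metis one_eq)
  with d(1) iff show ?thesis by (intro that) auto
qed

text \<open>Such an \<open>H\<close> consists of rotations, and conjugation fixes or inverts a
  rotation.\<close>

lemma normal_if_no_refl:
  assumes H: "subgroup H G" and "\<And>i. refl i \<notin> H"
  shows "H \<lhd> G"
proof -
  interpret subgroup H G by (rule H)
  have "x \<otimes> h \<otimes> inv x \<in> H" if x: "x \<in> carrier G" and h: "h \<in> H" for x h
  proof -
    obtain j where j: "h = rot j" using h assms(2) subset carrier_eq by blast
    have "rot (- j) \<in> H" using m_inv_closed[OF h] by (simp add: j inv_rot)
    then show ?thesis using x h by (auto simp: carrier_eq mult_simps j)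
  qed
  with H show ?thesis by (simp add: normal_inv_iff)
qed

text \<open>Conjugating \<open>refl j\<close> by \<open>rot i\<close> gives
  \<open>refl (j + 2 * i)\<close>, and by \<open>refl i\<close> gives
  \<open>refl (j + 2 * (i - j))\<close>; both differ from \<open>refl j\<close> by a power of
  \<open>rot 2\<close>.\<close>

lemma normal_if_rot_2:
  assumes H: "subgroup H G" and two: "rot 2 \<in> H"
  shows "H \<lhd> G"
proof -
  interpret subgroup H G by (rule H)
  have "x \<otimes> h \<otimes> inv x \<in> H" if x: "x \<in> carrier G" and h: "h \<in> H" for x h
  proof -
    have shift: "refl (j + 2 * k) \<in> H" if "h = refl j" for j k
      using m_closed[OF subgroup_rot_mult[OF H two, of k] h]
      by (simp add: that rot_refl add.commute)
    have "h \<in> carrier G" using h subset by blast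
    then consider j where "h = rot j" | j where "h = refl j" by (auto simp: carrier_eq)
    then show ?thesis
    proof cases
      case (1 j)
      then have "rot (- j) \<in> H" using m_inv_closed[OF h] by (simp add: inv_rot)
      with 1 show ?thesis using x h by (auto simp: carrier_eq mult_simps)
    next
      case (2 j)
      from x consider i where "x = rot i" | i where "x = refl i" by (auto simp: carrier_eq)
      then show ?thesis
      proof cases
        case (1 i)
        then show ?thesis using shift[OF 2, of i] by (simp add: 2 mult_simps algebra_simps)
      next
        case (2 i)
        then show ?thesis
          using shift[OF \<open>h = refl j\<close>, of "i - j"] \<open>h = refl j\<close>
          by (simp add: mult_simps algebra_simps)
      qed
    qed
  qed
  with H show ?thesis by (simp add: normal_inv_iff)
qed

section \<open>Subgroups containing reflections: classification, permutability and colouring\<close>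

definition refl_subgroup :: "nat \<Rightarrow> int \<Rightarrow> 'a set" where
  "refl_subgroup d i = rot ` {j. int d dvd j} \<union> refl ` {j. int d dvd j - i}"

text \<open>Exponents are determined only modulo \<open>n\<close>; \<open>d dvd n\<close> makes
  divisibility by \<open>d\<close> independent of the representative.\<close>

lemma rot_in_refl_subgroup:
  assumes "d dvd n"
  shows "rot j \<in> refl_subgroup d i \<longleftrightarrow> int d dvd j"
proof
  assume "rot j \<in> refl_subgroup d i"
  then obtain l where "int n dvd j - l" "int d dvd l"
    by (auto simp: refl_subgroup_def rot_eq_iff rot_neq_refl)
  moreover from this(1) have "int d dvd j - l" using assms by (meson dvd_trans int_dvd_int_iff)
  ultimately have "int d dvd (j - l) + l" by (intro dvd_add)
  then show "int d dvd j" by simp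
qed (auto simp: refl_subgroup_def)

lemma refl_in_refl_subgroup:
  assumes "d dvd n"
  shows "refl j \<in> refl_subgroup d i \<longleftrightarrow> int d dvd j - i"
proof
  assume "refl j \<in> refl_subgroup d i"
  then obtain l where "int n dvd j - l" "int d dvd l - i"
    by (auto simp: refl_subgroup_def refl_eq_iff rot_neq_refl[symmetric])
  moreover from this(1) have "int d dvd j - l" using assms by (meson dvd_trans int_dvd_int_iff)
  ultimately have "int d dvd (j - l) + (l - i)" by (intro dvd_add)
  then show "int d dvd j - i" by simp
qed (auto simp: refl_subgroup_def)

lemma subgroup_refl_subgroup: "subgroup (refl_subgroup d i) G"
proof (rule subgroupI)
  show "refl_subgroup d i \<subseteq> carrier G" by (auto simp: refl_subgroup_def)
  show "refl_subgroup d i \<noteq> {}" by (auto simp: refl_subgroup_def intro: exI[of _ 0])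
next
  fix x assume "x \<in> refl_subgroup d i"
  then show "inv x \<in> refl_subgroup d i" by (auto simp: refl_subgroup_def mult_simps)
next
  have shape: "(\<exists>k. z = rot (int d * k)) \<or> (\<exists>k. z = refl (i + int d * k))"
    if "z \<in> refl_subgroup d i" for z
  proof -
    from that consider j where "z = rot j" "int d dvd j" | j where "z = refl j" "int d dvd j - i"
      by (auto simp: refl_subgroup_def)
    then show ?thesis
    proof cases
      case 1
      then show ?thesis by (auto simp: dvd_def)
    next
      case (2 j)
      then obtain k where "j - i = int d * k" by (auto simp: dvd_def)
      then have "j = i + int d * k" by simp
      with 2 show ?thesis by blast
    qed
  qed
  have mem: "rot (int d * k) \<in> refl_subgroup d i" "refl (i + int d * k) \<in> refl_subgroup d i" for k
    by (auto simp: refl_subgroup_def)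
  fix x y assume "x \<in> refl_subgroup d i" "y \<in> refl_subgroup d i"
  then consider k l where "x = rot (int d * k)" "y = rot (int d * l)"
    | k l where "x = rot (int d * k)" "y = refl (i + int d * l)"
    | k l where "x = refl (i + int d * k)" "y = rot (int d * l)"
    | k l where "x = refl (i + int d * k)" "y = refl (i + int d * l)"
    using shape[of x] shape[of y] by metis
  then show "x \<otimes> y \<in> refl_subgroup d i"
  proof cases
    case (1 k l)
    then show ?thesis using mem(1)[of "k + l"] by (simp add: mult_simps algebra_simps)
  next
    case (2 k l)
    then show ?thesis using mem(2)[of "k + l"] by (simp add: mult_simps algebra_simps)
  next
    case (3 k l)
    then show ?thesis using mem(2)[of "k - l"] by (simp add: mult_simps algebra_simps)
  next
    case (4 k l)
    then show ?thesis using mem(1)[of "k - l"] by (simp add: mult_simps algebra_simps)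
  qed
qed

text \<open>Conjugating \<open>refl i\<close> by \<open>rot 1\<close> gives
  \<open>refl (i + 2)\<close>, which would force \<open>d\<close> to divide 2.\<close>

lemma refl_subgroup_not_normal:
  assumes "d dvd n" "d \<ge> 3"
  shows "\<not> refl_subgroup d i \<lhd> G"
proof
  assume "refl_subgroup d i \<lhd> G"
  moreover have "refl i \<in> refl_subgroup d i" by (simp add: refl_in_refl_subgroup assms)
  ultimately have "rot 1 \<otimes> refl i \<otimes> inv rot 1 \<in> refl_subgroup d i"
    using normal_inv_iff rot_closed by blast
  then have "int d dvd 2" by (simp add: mult_simps refl_in_refl_subgroup assms)
  then show False using assms(2) zdvd_imp_le by fastforce
qed

lemma non_normal_subgroup_cases:
  assumes H: "subgroup H G" "\<not> H \<lhd> G"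
  obtains d i where "d dvd n" "d \<ge> 3" "i \<in> {0..<int d}" "H = refl_subgroup d i"
proof -
  interpret subgroup H G by (rule H)
  obtain d where d: "d > 0" "d dvd n" "\<And>i. rot i \<in> H \<longleftrightarrow> int d dvd i"
    by (rule subgroup_rot_generator[OF H(1)]) blast
  have "\<not> int d dvd 2" using normal_if_rot_2[OF H(1)] H(2) d(3) by blast
  then have "d \<noteq> 1" "d \<noteq> 2" by auto
  with d(1) have "d \<ge> 3" by simp
  obtain j where j: "refl j \<in> H" using normal_if_no_refl[OF H(1)] H(2) by blast
  \<comment> \<open>The reflections in \<open>H\<close> form one coset of its rotations, so the
    residue of \<open>j\<close> modulo \<open>d\<close> determines them all.\<close>
  have refl_iff: "refl l \<in> H \<longleftrightarrow> int d dvd l - j mod int d" for l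
  proof -
    have "refl l \<in> H \<longleftrightarrow> rot (l - j) \<in> H"
    proof
      assume "refl l \<in> H"
      from m_closed[OF this j] show "rot (l - j) \<in> H" by (simp add: refl_refl)
    next
      assume "rot (l - j) \<in> H"
      from m_closed[OF this j] show "refl l \<in> H" by (simp add: rot_refl)
    qed
    then show ?thesis by (simp add: d(3) mod_eq_dvd_iff[symmetric])
  qed
  have "x \<in> H \<longleftrightarrow> x \<in> refl_subgroup d (j mod int d)" if "x \<in> carrier G" for x
    using that d(3) refl_iff
    by (auto simp: carrier_eq rot_in_refl_subgroup[OF d(2)] refl_in_refl_subgroup[OF d(2)])
  then have "H = refl_subgroup d (j mod int d)"
    using subset subgroup.subset[OF subgroup_refl_subgroup] by blast
  then show ?thesis using d \<open>d \<ge> 3\<close> by (intro that[of d "j mod int d"]) auto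
qed

text \<open>The product \<open>refl i \<otimes> refl j\<close>, which is \<open>rot (i - j)\<close>,
  must also be some \<open>k \<otimes> h\<close>. If \<open>k\<close> and \<open>h\<close> are
  rotations, \<open>t\<close> divides \<open>i - j\<close>; if they are reflections, the exponent of
  their product is congruent to \<open>j - i\<close> modulo \<open>t\<close>, whence the factor
  2.\<close>

lemma permutable_refl_subgroups:
  assumes "t dvd n" "subgroup H G" "subgroup K G" "H <#> K = K <#> H"
    and H: "\<And>i. rot i \<in> H \<Longrightarrow> int t dvd i" "refl i \<in> H"
    and K: "\<And>i. rot i \<in> K \<Longrightarrow> int t dvd i" "refl j \<in> K"
  shows "int t dvd 2 * (i - j)"
proof -
  have H': "int t dvd i' - i" if "refl i' \<in> H" for i'
    using H subgroup.m_closed[OF assms(2) that H(2)] by (simp add: refl_refl)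
  have K': "int t dvd j' - j" if "refl j' \<in> K" for j'
    using K subgroup.m_closed[OF assms(3) that K(2)] by (simp add: refl_refl)
  have "refl i \<otimes> refl j \<in> H <#> K" using H(2) K(2) by (auto simp: set_mult_def)
  then have "refl i \<otimes> refl j \<in> K <#> H" by (simp only: assms(4))
  then obtain k h where kh: "k \<in> K" "h \<in> H" "rot (i - j) = k \<otimes> h"
    by (auto simp: set_mult_def refl_refl)
  have tn: "int t dvd x - y" if "rot x = rot y" for x y
    using that assms(1) by (meson dvd_trans int_dvd_int_iff rot_eq_iff)
  have "k \<in> carrier G" "h \<in> carrier G"
    using kh assms(2,3) subgroup.subset by blast+
  \<comment> \<open>A rotation times a reflection, in either order, is a reflection, so the mixed
    cases cannot yield \<open>rot (i - j)\<close>.\<close>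
  then consider a b where "k = rot a" "h = rot b" | a b where "k = refl a" "h = refl b"
    using kh(3) by (fastforce simp: carrier_eq mult_simps rot_neq_refl)
  then show ?thesis
  proof cases
    case 1
    then have "int t dvd i - j - (a + b)" "int t dvd a" "int t dvd b"
      using kh H K tn by (auto simp: rot_rot)
    then have "int t dvd (i - j - (a + b)) + (a + b)" by (intro dvd_add)
    then have "int t dvd i - j" by simp
    then show ?thesis by (rule dvd_mult)
  next
    case 2
    then have "int t dvd i - j - (a - b)" "int t dvd a - j" "int t dvd b - i"
      using kh H' K' tn by (auto simp: refl_refl)
    then have "int t dvd (i - j - (a - b)) + ((a - j) - (b - i))" by (rule dvd_add[OF _ dvd_diff])
    then show ?thesis by (simp add: algebra_simps)
  qed
qed

text \<open>The graph is cut along \<open>\<not> t dvd d\<close> and coloured by \<open>i mod c\<close>.\<close>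

lemma not_hamiltonian_permutability_graph:
  assumes t: "t dvd n" "t \<ge> 3" and c: "c \<ge> 2" "c dvd t"
    and half: "\<And>x. int t dvd 2 * x \<Longrightarrow> int c dvd x"
    and sum: "(\<Sum>d | d dvd n \<and> d \<ge> 3 \<and> \<not> t dvd d. d) < c"
  shows "\<not> pre_digraph.hamiltonian (with_proj (\<Gamma>\<^sub>N G))"
proof -
  define V where "V = pverts (\<Gamma>\<^sub>N G)"
  \<comment> \<open>The cut is read off from rotations: for \<open>refl_subgroup d i\<close> with
    \<open>d dvd n\<close> the condition amounts to \<open>\<not> t dvd d\<close>.\<close>
  define S where "S = {H \<in> V. \<exists>i. rot i \<in> H \<and> \<not> int t dvd i}"
  \<comment> \<open>Off \<open>S\<close> the choice does not matter: all reflections in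
    \<open>H\<close> have exponents congruent modulo \<open>t\<close>, hence modulo
    \<open>c\<close>.\<close>
  define f where "f H = (SOME i. refl i \<in> H) mod int c" for H
  define D where "D = {d. d dvd n \<and> d \<ge> 3 \<and> \<not> t dvd d}"
  have V: "subgroup H G \<and> \<not> H \<lhd> G" if "H \<in> V" for H
    using that by (auto simp: V_def permutability_graph_N_def Let_def)
  have finD: "finite D" unfolding D_def using n_pos by (auto intro: finite_subset[OF _ finite_divisors_nat])
  \<comment> \<open>Each \<open>d\<close> contributes at most \<open>d\<close> subgroups, so
    \<open>card S\<close> is at most the sum bounded in \<open>sum\<close>.\<close>
  have S: "S \<subseteq> (\<lambda>(d, i). refl_subgroup d i) ` (SIGMA d:D. {0..<int d})"
  proof
    fix H assume H: "H \<in> S"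
    then obtain d i where d: "d dvd n" "d \<ge> 3" "i \<in> {0..<int d}" "H = refl_subgroup d i"
      using V non_normal_subgroup_cases[of H] unfolding S_def by blast
    obtain j where "rot j \<in> H" "\<not> int t dvd j" using H by (auto simp: S_def)
    then have "\<not> t dvd d"
      using d by (metis dvd_trans int_dvd_int_iff rot_in_refl_subgroup)
    with d show "H \<in> (\<lambda>(d, i). refl_subgroup d i) ` (SIGMA d:D. {0..<int d})"
      by (auto simp: D_def)
  qed
  have finS: "finite S" by (rule finite_subset[OF S]) (use finD in auto)
  have "card S \<le> card (SIGMA d:D. {0..<int d})" by (rule surj_card_le[OF _ S]) (use finD in auto)
  also have "\<dots> = (\<Sum>d\<in>D. d)" using finD by (simp add: card_SigmaI)
  also have "\<dots> < c" using sum by (simp add: D_def)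
  finally have cardS: "card S < c" .
  have f: "f H = i mod int c" if "H \<in> V" "H \<notin> S" "refl i \<in> H" for H i
  proof -
    have some: "refl (SOME i. refl i \<in> H) \<in> H" using that(3) by (rule someI)
    have "rot ((SOME i. refl i \<in> H) - i) \<in> H"
      using subgroup.m_closed[of H G, OF _ some that(3)] V[OF that(1)] by (simp add: refl_refl)
    then have "int t dvd (SOME i. refl i \<in> H) - i" using that by (auto simp: S_def)
    then have "int c dvd (SOME i. refl i \<in> H) - i" using c(2) by (meson dvd_trans int_dvd_int_iff)
    then show ?thesis by (simp add: f_def mod_eq_dvd_iff)
  qed
  have refl_ex: "\<exists>i. refl i \<in> H" if "H \<in> V" for H
    using V[OF that] normal_if_no_refl by blast
  have col: "f H = f K" if e: "(H, K) \<in> parcs (\<Gamma>\<^sub>N G)" "H \<notin> S" "K \<notin> S" for H K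
  proof -
    have HK: "H \<in> V" "K \<in> V" "H <#> K = K <#> H"
      using e by (auto simp: V_def permutability_graph_N_def Let_def)
    obtain i j where ij: "refl i \<in> H" "refl j \<in> K" using HK refl_ex by blast
    \<comment> \<open>Off \<open>S\<close> all rotations in \<open>H\<close> and \<open>K\<close>
      have exponents divisible by \<open>t\<close>; \<open>half\<close> then turns the result into a
      congruence modulo \<open>c\<close>.\<close>
    have "int t dvd 2 * (i - j)"
      by (rule permutable_refl_subgroups[of t H K, OF t(1) _ _ HK(3) _ ij(1) _ ij(2)])
        (use e HK V in \<open>auto simp: S_def\<close>)
    from half[OF this] have "i mod int c = j mod int c" by (simp add: mod_eq_dvd_iff)
    then show ?thesis using f HK e ij by metis
  qed
  \<comment> \<open>Every residue modulo \<open>c\<close> occurs as a colour, witnessed by a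
    subgroup with \<open>d = t\<close>, which survives the cut.\<close>
  have "int ` {..<c} \<subseteq> f ` (V - S)"
  proof clarify
    fix i assume "i < c"
    let ?H = "refl_subgroup t (int i)"
    have N: "subgroup ?H G" "\<not> ?H \<lhd> G"
      using subgroup_refl_subgroup refl_subgroup_not_normal t by blast+
    \<comment> \<open>The whole group is normal and \<open>?H\<close> is not, so \<open>?H\<close>
      is proper.\<close>
    moreover have "carrier G \<lhd> G" by (simp add: normal_inv_iff subgroup_self)
    ultimately have H: "?H \<in> V" by (auto simp: V_def permutability_graph_N_def Let_def)
    have "?H \<notin> S" using t by (auto simp: S_def rot_in_refl_subgroup)
    moreover have "refl (int i) \<in> ?H" using t by (simp add: refl_in_refl_subgroup)
    ultimately have "f ?H = int i" using f[OF H] \<open>i < c\<close> by simp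
    then show "int i \<in> f ` (V - S)" using H \<open>?H \<notin> S\<close> by (metis DiffI imageI)
  qed
  moreover have "finite (f ` (V - S))"
    by (rule finite_subset[of _ "{0..<int c}"]) (use c in \<open>auto simp: f_def\<close>)
  ultimately have "card (int ` {..<c}) \<le> card (f ` (V - S))" by (rule card_mono[rotated])
  then have "c \<le> card (f ` (V - S))" by (simp add: card_image)
  then show ?thesis
    using pre_digraph.not_hamiltonian_coloured_cut[of S "with_proj (\<Gamma>\<^sub>N G)" f] finS cardS c(1) col
    by (auto simp: V_def)
qed

end


section \<open>The presented dihedral group\<close>

text \<open>The value \<open>(i, s)\<close> of a word stands for \<open>a\<^sup>i\<close> if \<open>s\<close> is false and for \<open>a\<^sup>i b\<close> otherwise.\<close>

fun dihedral_mult :: "int \<times> bool \<Rightarrow> int \<times> bool \<Rightarrow> int \<times> bool" where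
  "dihedral_mult (i, s) (j, t) = (if s then i - j else i + j, s \<noteq> t)"

text \<open>Values live in the infinite dihedral group, where b is an involution, so
  \<open>Gen_b\<close> and its formal inverse share a value. Reduction modulo \<open>n\<close> comes
  only in \<open>word_cong_value\<close>.\<close>

fun letter_value :: "dihedral_gen \<times> bool \<Rightarrow> int \<times> bool" where
  "letter_value (Gen_a, e) = (if e then 1 else - 1, False)"
| "letter_value (Gen_b, e) = (0, True)"

fun word_value :: "dihedral_gen gword \<Rightarrow> int \<times> bool" where
  "word_value [] = (0, False)"
| "word_value (x # u) = dihedral_mult (letter_value x) (word_value u)"

lemma dihedral_mult_assoc:
  "dihedral_mult (dihedral_mult x y) z = dihedral_mult x (dihedral_mult y z)"
  by (cases x; cases y; cases z) auto

lemma word_value_append: "word_value (u @ v) = dihedral_mult (word_value u) (word_value v)"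
proof (induction u)
  case Nil show ?case by (cases "word_value v") simp
qed (simp add: dihedral_mult_assoc)

lemma word_value_replicate_a:
  "word_value (replicate k (Gen_a, e)) = (if e then int k else - int k, False)"
  by (induction k) auto

text \<open>This invariant bounds the presented group from below: words whose values differ modulo
  \<open>n\<close> cannot be identified by the relations.\<close>

lemma word_cong_value:
  assumes "word_cong (dihedral_relations n) u v"
  shows "int n dvd fst (word_value u) - fst (word_value v) \<and>
    snd (word_value u) = snd (word_value v)"
  using assms
proof (induction rule: word_cong.induct)
  case (wc_sym u v)
  then show ?case by (metis dvd_diff_commute)
next
  case (wc_trans u v w)
  then show ?case by (metis diff_add_cancel add_diff_eq dvd_add)
next
  case (wc_append u u' v v')
  obtain i s i' s' where u: "word_value u = (i, s)" "word_value u' = (i', s')" by fastforce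
  obtain j t j' t' where v: "word_value v = (j, t)" "word_value v' = (j', t')" by fastforce
  have d: "int n dvd i - i'" "int n dvd j - j'" using wc_append.IH by (auto simp: u v)
  show ?case
    using wc_append.IH dvd_add[OF d] dvd_diff[OF d]
    by (auto simp: word_value_append u v algebra_simps)
next
  case (wc_cancel g e)
  show ?case by (cases g) auto
next
  case (wc_relation u v)
  then show ?case
    by (auto simp: dihedral_relations_def word_value_replicate_a numeral_2_eq_2)
qed simp

section \<open>Normal forms in the presented group\<close>

abbreviation dihedral_class :: "nat \<Rightarrow> dihedral_gen gword \<Rightarrow> dihedral_gen gword set" where
  "dihedral_class n u \<equiv> word_cong_rel (dihedral_relations n) `` {u}"

lemma (in group) int_pow_reflected:
  assumes x: "x \<in> carrier G" and y: "y \<in> carrier G" and "x \<otimes> y = y \<otimes> inv x"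
  shows "x [^] (i::int) \<otimes> y = y \<otimes> x [^] (- i)"
proof -
  have pos: "x [^] int k \<otimes> y = y \<otimes> x [^] (- int k)" for k
  proof (induction k)
    case 0
    show ?case using y by simp
  next
    case (Suc k)
    have "x [^] int (Suc k) \<otimes> y = x [^] int k \<otimes> (x \<otimes> y)"
      using x y int_pow_mult[of x "int k" 1] by (simp add: m_assoc add.commute)
    also have "\<dots> = y \<otimes> (x [^] (- int k) \<otimes> x [^] (- 1 :: int))"
      using x y Suc by (simp add: assms(3) m_assoc[symmetric] int_pow_neg)
    also have "x [^] (- int k) \<otimes> x [^] (- 1 :: int) = x [^] (- int (Suc k))"
      using x by (simp add: int_pow_mult[symmetric] algebra_simps)
    finally show ?case .
  qed
  have neg: "x [^] (- int k) \<otimes> y = y \<otimes> x [^] int k" for k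
  proof -
    \<comment> \<open>Inserting cancelling powers creates the right-hand side of \<open>pos\<close>;
      rewriting it back cancels the powers on the left.\<close>
    have "x [^] (- int k) \<otimes> y = x [^] (- int k) \<otimes> (y \<otimes> x [^] (- int k)) \<otimes> x [^] int k"
      using x y by (simp add: m_assoc int_pow_mult[symmetric])
    also have "\<dots> = x [^] (- int k) \<otimes> x [^] int k \<otimes> y \<otimes> x [^] int k"
      using x y by (simp only: pos[symmetric] m_assoc int_pow_closed m_closed)
    also have "\<dots> = y \<otimes> x [^] int k"
      using x y by (simp add: int_pow_mult[symmetric])
    finally show ?thesis .
  qed
  show ?thesis using pos[of "nat i"] neg[of "nat (- i)"] by (cases "i \<ge> 0") auto
qed

text \<open>The relations give the multiplication table and reduce every word to a normal form; word
  values keep different normal forms apart.\<close>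

lemma dihedral_dihedral_group:
  assumes "n > 0"
  defines "a \<equiv> dihedral_class n [(Gen_a, True)]" and "b \<equiv> dihedral_class n [(Gen_b, True)]"
  shows "dihedral (dihedral_group n) n (\<lambda>i. a [^]\<^bsub>dihedral_group n\<^esub> i)
    (\<lambda>i. a [^]\<^bsub>dihedral_group n\<^esub> i \<otimes>\<^bsub>dihedral_group n\<^esub> b)"
proof -
  define G where "G = dihedral_group n"
  interpret group G unfolding G_def by (rule group_dihedral_group)
  let ?c = "dihedral_class n"
  have mult: "?c u \<otimes>\<^bsub>G\<^esub> ?c v = ?c (u @ v)" for u v
    by (simp add: G_def dihedral_group_def word_class_mult)
  have one: "\<one>\<^bsub>G\<^esub> = ?c []"
    by (simp add: G_def dihedral_group_def presented_group_def)
  have closed [simp]: "?c u \<in> carrier G" for u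
    by (simp add: G_def dihedral_group_def word_class_in_carrier)
  have [simp]: "a \<in> carrier G" "b \<in> carrier G" by (simp_all add: a_def b_def)
  have rel: "?c u = ?c v" if "(u, v) \<in> dihedral_relations n" for u v
    using that by (simp add: word_class_eq_iff wc_relation)
  have inv_letter: "inv\<^bsub>G\<^esub> ?c [(g, True)] = ?c [(g, False)]" for g
    using wc_cancel[of "dihedral_relations n" g False]
    by (intro inv_equality) (simp_all add: mult one word_class_eq_iff)
  have replicate: "?c (replicate k x) = ?c [x] [^]\<^bsub>G\<^esub> k" for k x
  proof (induction k)
    case 0
    show ?case by (simp add: one)
  next
    case (Suc k)
    have "?c (replicate (Suc k) x) = ?c (replicate k x) \<otimes>\<^bsub>G\<^esub> ?c [x]"
      by (simp add: mult replicate_append_same)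
    then show ?case by (simp only: Suc nat_pow_Suc)
  qed
  \<comment> \<open>Representing each power by an explicit word lets \<open>word_cong_value\<close>
    compare powers.\<close>
  have pow: "a [^]\<^bsub>G\<^esub> i = ?c (replicate (nat \<bar>i\<bar>) (Gen_a, i \<ge> 0))" for i :: int
  proof (cases "i \<ge> 0")
    case True
    then show ?thesis by (simp only: replicate a_def int_pow_def2) simp
  next
    case False
    have "a [^]\<^bsub>G\<^esub> i = (inv\<^bsub>G\<^esub> a) [^]\<^bsub>G\<^esub> (- i)"
      by (simp add: int_pow_inv int_pow_neg)
    also have "\<dots> = (inv\<^bsub>G\<^esub> a) [^]\<^bsub>G\<^esub> nat (- i)"
      using False int_pow_int[of G "inv\<^bsub>G\<^esub> a" "nat (- i)"] by simp
    also have "\<dots> = ?c (replicate (nat (- i)) (Gen_a, False))"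
      by (simp only: replicate a_def inv_letter)
    finally show ?thesis using False by simp
  qed
  have "?c (replicate n (Gen_a, True)) = ?c []"
    by (rule rel) (simp add: dihedral_relations_def)
  then have an: "a [^]\<^bsub>G\<^esub> int n = \<one>\<^bsub>G\<^esub>" by (simp add: pow one)
  have "?c [(Gen_b, True), (Gen_b, True)] = ?c []"
    by (rule rel) (simp add: dihedral_relations_def numeral_2_eq_2)
  then have bb: "b \<otimes>\<^bsub>G\<^esub> b = \<one>\<^bsub>G\<^esub>" by (simp add: b_def mult one)
  have "?c [(Gen_a, True), (Gen_b, True)] = ?c [(Gen_b, True), (Gen_a, False)]"
    by (rule rel) (simp add: dihedral_relations_def)
  then have ab: "a \<otimes>\<^bsub>G\<^esub> b = b \<otimes>\<^bsub>G\<^esub> inv\<^bsub>G\<^esub> a"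
    by (simp add: a_def b_def mult inv_letter)
  have ba: "b \<otimes>\<^bsub>G\<^esub> a [^]\<^bsub>G\<^esub> i = a [^]\<^bsub>G\<^esub> (- i) \<otimes>\<^bsub>G\<^esub> b" for i :: int
    using int_pow_reflected[OF _ _ ab, of "- i"] by simp
  have invb: "inv\<^bsub>G\<^esub> b = b" by (rule inv_equality) (simp_all add: bb)
  have rr: "a [^]\<^bsub>G\<^esub> i \<otimes>\<^bsub>G\<^esub> (b \<otimes>\<^bsub>G\<^esub> a [^]\<^bsub>G\<^esub> j) = a [^]\<^bsub>G\<^esub> (i - j) \<otimes>\<^bsub>G\<^esub> b" for i j :: int
  proof -
    have "a [^]\<^bsub>G\<^esub> i \<otimes>\<^bsub>G\<^esub> (b \<otimes>\<^bsub>G\<^esub> a [^]\<^bsub>G\<^esub> j) = a [^]\<^bsub>G\<^esub> i \<otimes>\<^bsub>G\<^esub> a [^]\<^bsub>G\<^esub> (- j) \<otimes>\<^bsub>G\<^esub> b"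
      unfolding ba by (simp only: m_assoc int_pow_closed \<open>a \<in> carrier G\<close> \<open>b \<in> carrier G\<close>)
    then show ?thesis using int_pow_mult[of a i "- j"] by simp
  qed
  have value_rot: "word_value (replicate (nat \<bar>i\<bar>) (Gen_a, i \<ge> 0)) = (i, False)" for i
    by (simp add: word_value_replicate_a)
  have value_refl: "word_value (replicate (nat \<bar>i\<bar>) (Gen_a, i \<ge> 0) @ [(Gen_b, True)]) = (i, True)" for i
    by (simp add: word_value_append value_rot)
  have pow_eq: "a [^]\<^bsub>G\<^esub> i = a [^]\<^bsub>G\<^esub> j \<longleftrightarrow> int n dvd i - j" for i j :: int
  proof
    assume "a [^]\<^bsub>G\<^esub> i = a [^]\<^bsub>G\<^esub> j"
    then show "int n dvd i - j"
      using word_cong_value value_rot by (metis pow word_class_eq_iff fst_conv)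
  next
    assume "int n dvd i - j"
    then obtain k where k: "i = int n * k + j" by (metis diff_add_cancel dvdE)
    have "a [^]\<^bsub>G\<^esub> (int n * k) = \<one>\<^bsub>G\<^esub>"
      by (simp add: int_pow_pow[symmetric] an)
    then show "a [^]\<^bsub>G\<^esub> i = a [^]\<^bsub>G\<^esub> j" by (simp add: k int_pow_mult)
  qed
  have neq: "a [^]\<^bsub>G\<^esub> i \<noteq> a [^]\<^bsub>G\<^esub> j \<otimes>\<^bsub>G\<^esub> b" for i j :: int
  proof
    assume "a [^]\<^bsub>G\<^esub> i = a [^]\<^bsub>G\<^esub> j \<otimes>\<^bsub>G\<^esub> b"
    then have "word_cong (dihedral_relations n) (replicate (nat \<bar>i\<bar>) (Gen_a, i \<ge> 0))
        (replicate (nat \<bar>j\<bar>) (Gen_a, j \<ge> 0) @ [(Gen_b, True)])"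
      by (simp only: pow b_def mult word_class_eq_iff)
    from word_cong_value[OF this] show False by (simp add: value_rot value_refl)
  qed
  let ?N = "range (\<lambda>i::int. a [^]\<^bsub>G\<^esub> i) \<union> range (\<lambda>i::int. a [^]\<^bsub>G\<^esub> i \<otimes>\<^bsub>G\<^esub> b)"
  \<comment> \<open>Left multiplication by the class of any letter preserves the set
    \<open>?N\<close> of normal forms.\<close>
  have class_mem: "?c u \<in> ?N" for u
  proof (induction u)
    case Nil
    have "?c [] = a [^]\<^bsub>G\<^esub> (0::int)" by (simp add: one)
    then show ?case by blast
  next
    case (Cons x u)
    have split: "?c (x # u) = ?c [x] \<otimes>\<^bsub>G\<^esub> ?c u" by (simp add: mult)
    obtain g e where x: "x = (g, e)" by (cases x)
    show ?case
    proof (cases g)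
      case Gen_a
      have "?c [x] = a [^]\<^bsub>G\<^esub> (if e then 1 else - 1 :: int)"
        by (simp add: pow x Gen_a)
      then obtain k :: int where "?c [x] = a [^]\<^bsub>G\<^esub> k" by blast
      with Cons.IH show ?thesis
        by (auto simp: split m_assoc[symmetric] int_pow_mult[symmetric])
    next
      case Gen_b
      have "?c [x] = b" using inv_letter[of Gen_b] by (cases e) (auto simp: x Gen_b b_def[symmetric] invb)
      then have c: "?c (x # u) = b \<otimes>\<^bsub>G\<^esub> ?c u" by (simp only: split)
      have "b \<otimes>\<^bsub>G\<^esub> (a [^]\<^bsub>G\<^esub> i \<otimes>\<^bsub>G\<^esub> b) = a [^]\<^bsub>G\<^esub> (- i)" for i :: int
        using ba[of i] m_assoc[of b "a [^]\<^bsub>G\<^esub> i" b] m_assoc[of "a [^]\<^bsub>G\<^esub> (- i)" b b] by (simp add: bb)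
      then show ?thesis using Cons.IH ba unfolding c by fastforce
    qed
  qed
  show ?thesis
    unfolding G_def[symmetric]
  proof
    show "carrier G = ?N"
    proof
      show "carrier G \<subseteq> ?N"
      proof
        fix x assume "x \<in> carrier G"
        then obtain u where "x = ?c u" unfolding G_def dihedral_group_def by (rule word_class_cases)
        with class_mem show "x \<in> ?N" by blast
      qed
    qed auto
  next
    fix i j :: int
    show "a [^]\<^bsub>G\<^esub> i \<otimes>\<^bsub>G\<^esub> a [^]\<^bsub>G\<^esub> j = a [^]\<^bsub>G\<^esub> (i + j)" by (simp add: int_pow_mult)
    show "a [^]\<^bsub>G\<^esub> i \<otimes>\<^bsub>G\<^esub> (a [^]\<^bsub>G\<^esub> j \<otimes>\<^bsub>G\<^esub> b) = a [^]\<^bsub>G\<^esub> (i + j) \<otimes>\<^bsub>G\<^esub> b"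
      by (simp add: int_pow_mult m_assoc)
    show "a [^]\<^bsub>G\<^esub> i \<otimes>\<^bsub>G\<^esub> b \<otimes>\<^bsub>G\<^esub> a [^]\<^bsub>G\<^esub> j = a [^]\<^bsub>G\<^esub> (i - j) \<otimes>\<^bsub>G\<^esub> b"
      by (simp add: rr m_assoc)
    have "a [^]\<^bsub>G\<^esub> i \<otimes>\<^bsub>G\<^esub> b \<otimes>\<^bsub>G\<^esub> (a [^]\<^bsub>G\<^esub> j \<otimes>\<^bsub>G\<^esub> b) = a [^]\<^bsub>G\<^esub> i \<otimes>\<^bsub>G\<^esub> (b \<otimes>\<^bsub>G\<^esub> a [^]\<^bsub>G\<^esub> j) \<otimes>\<^bsub>G\<^esub> b"
      by (simp add: m_assoc)
    also have "\<dots> = a [^]\<^bsub>G\<^esub> (i - j)" unfolding rr by (simp add: m_assoc bb)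
    finally show "a [^]\<^bsub>G\<^esub> i \<otimes>\<^bsub>G\<^esub> b \<otimes>\<^bsub>G\<^esub> (a [^]\<^bsub>G\<^esub> j \<otimes>\<^bsub>G\<^esub> b) = a [^]\<^bsub>G\<^esub> (i - j)" .
    show "a [^]\<^bsub>G\<^esub> i \<otimes>\<^bsub>G\<^esub> b = a [^]\<^bsub>G\<^esub> j \<otimes>\<^bsub>G\<^esub> b \<longleftrightarrow> int n dvd i - j"
      by (simp add: pow_eq)
  qed (use assms(1) pow_eq neq in auto)
qed


section \<open>Deficient numbers\<close>

lemma deficient_sum_not_multiples:
  assumes "deficient (2 ^ k * m)" "m > 0"
  shows "(\<Sum>d | d dvd 2 ^ k * m \<and> \<not> m dvd d. d) < m"
proof -
  let ?D = "{d. d dvd 2 ^ k * m}"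
  let ?M = "(\<lambda>j. 2 ^ j * m) ` {..k}"
  have fin: "finite ?D" using assms(2) by (simp add: finite_divisors_nat)
  have "(\<Sum>d\<in>?M. d) = (\<Sum>j\<le>k. 2 ^ j * m)"
    by (rule sum.reindex_cong[of "\<lambda>j. 2 ^ j * m"]) (use assms(2) in \<open>auto simp: inj_on_def\<close>)
  also have "\<dots> = (\<Sum>j<Suc k. 2 ^ j) * m"
    by (simp only: sum_distrib_right lessThan_Suc_atMost)
  also have "(\<Sum>j<Suc k. 2 ^ j) = 2 ^ Suc k - (1::nat)"
    using mask_eq_sum_exp_nat[of "Suc k"] by (simp add: lessThan_def)
  \<comment> \<open>The geometric sum \<open>2n - m\<close>, written additively to avoid truncated
    subtraction.\<close>
  finally have M: "(\<Sum>d\<in>?M. d) + m = 2 * (2 ^ k * m)"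
    by (simp add: diff_mult_distrib)
  \<comment> \<open>The sets are disjoint because \<open>?M\<close> consists of multiples of
    \<open>m\<close>.\<close>
  have "(\<Sum>d | d dvd 2 ^ k * m \<and> \<not> m dvd d. d) + (\<Sum>d\<in>?M. d) = (\<Sum>d\<in>{d\<in>?D. \<not> m dvd d} \<union> ?M. d)"
    by (subst sum.union_disjoint) (use fin in auto)
  also have "\<dots> \<le> (\<Sum>d\<in>?D. d)"
    by (rule sum_mono2[OF fin]) (auto simp: le_imp_power_dvd)
  also have "\<dots> < 2 * (2 ^ k * m)" using assms(1) by (simp add: deficient_def sum_of_divisors_def)
  finally show ?thesis using M by linarith
qed

section \<open>Choice of the cut: powers of two, and numbers with odd part above 1\<close>

theorem theorem4p6:
  fixes n :: nat
  assumes "n \<ge> 3"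
    and "deficient n"
  shows "\<not> pre_digraph.hamiltonian (with_proj (\<Gamma>\<^sub>N (dihedral_group n)))"
proof -
  interpret dihedral "dihedral_group n" n
    "\<lambda>i. dihedral_class n [(Gen_a, True)] [^]\<^bsub>dihedral_group n\<^esub> i"
    "\<lambda>i. dihedral_class n [(Gen_a, True)] [^]\<^bsub>dihedral_group n\<^esub> i
      \<otimes>\<^bsub>dihedral_group n\<^esub> dihedral_class n [(Gen_b, True)]"
    using assms(1) by (intro dihedral_dihedral_group) simp
  obtain m where m: "n = 2 ^ multiplicity 2 n * m" "odd m"
    using multiplicity_decompose'[of n 2] assms(1) by auto
  define k where "k = multiplicity 2 n"
  have n: "n = 2 ^ k * m" using m by (simp add: k_def)
  show ?thesis
  proof (cases "m = 1")
    case True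
    \<comment> \<open>For a power of two take \<open>t = 4\<close> and \<open>c = 2\<close>: the cut
      is empty, and the colours are the two parities.\<close>
    have dvd4: "4 dvd d" if d: "d dvd n" "d \<ge> 3" for d
    proof -
      obtain j where j: "d = 2 ^ j" 
        using d(1) n True divides_primepow_nat[OF two_is_prime_nat, of d k] by auto
      then have "j \<noteq> 0" "j \<noteq> 1" using d(2) by (auto intro: ccontr)
      then have "2 ^ 2 dvd d" unfolding j by (intro le_imp_power_dvd) simp
      then show ?thesis by simp
    qed
    then have "{d. d dvd n \<and> d \<ge> 3 \<and> \<not> 4 dvd d} = {}" by blast
    then have "(\<Sum>d | d dvd n \<and> d \<ge> 3 \<and> \<not> 4 dvd d. d) < 2" by (simp only: sum.empty)
    moreover have "4 dvd n" using dvd4[of n] assms(1) by simp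
    moreover have "int 2 dvd x" if "int 4 dvd 2 * x" for x using that by simp presburger
    ultimately show ?thesis
      by (intro not_hamiltonian_permutability_graph[of 4 2]) simp_all
  next
    case False
    then have "m \<ge> 3" using m(2) by (cases "m = 2") (auto elim: oddE)
    \<comment> \<open>Here \<open>t\<close> and \<open>c\<close> are both \<open>m\<close>. Dropping
      \<open>d \<ge> 3\<close> can only enlarge the sum, which deficiency then bounds.\<close>
    have "(\<Sum>d | d dvd n \<and> d \<ge> 3 \<and> \<not> m dvd d. d) \<le> (\<Sum>d | d dvd n \<and> \<not> m dvd d. d)"
      using assms(1) by (intro sum_mono2) (auto intro: finite_subset[OF _ finite_divisors_nat[of n]])
    also have "\<dots> < m"
      using deficient_sum_not_multiples[of k m] assms(2) m(2) n by (auto intro: odd_pos)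
    finally have sum: "(\<Sum>d | d dvd n \<and> d \<ge> 3 \<and> \<not> m dvd d. d) < m" .
    have half: "int m dvd x" if "int m dvd 2 * x" for x
    proof -
      have "coprime (int m) 2" using m(2) by simp
      then show ?thesis by (rule iffD1[OF coprime_dvd_mult_right_iff that])
    qed
    have "m dvd n" unfolding n by simp
    then show ?thesis
      by (rule not_hamiltonian_permutability_graph[OF _ \<open>m \<ge> 3\<close> _ _ half sum])
        (use \<open>m \<ge> 3\<close> in simp_all)
  qed
qed

end
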